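(* In the setting described in the context, let $\theta\in\mathbb{R}^m$ be defined by $$\theta_k=(m+1)\max_i\Big(\max_{x_i\in X_i}((A_i)_{k,:})^\top x_i-\min_{x_i\in X_i}((A_i)_{k,:})^\top x_i\Big),\qquad k=1,\dots,m,$$ where $(A_i)_{k,:}$ is the $k$-th row of $A_i$. Suppose there exist $\xi>0$ and $\hat x_i\in\operatorname{conv}X_i$, $i=1,\dots,n$, such that $$\sum_{i=1}^nA_i\hat x_i\le b-\theta-n\xi\mathbf 1_m .$$ Let $v^*_\theta$ be the optimal value of the perturbed problem of minimizing $\sum_if_i^{**}(x_i)$ subject to $Ax\le b-\theta$, $x_i\in\operatorname{conv}X_i$. Run the Frank-Wolfe stage for $K\ge1$ iterations with target $z^*=(v^*_\theta,b-\theta)$ (i.e. apply the method to the perturbed problem), followed by the trimming stage. Define $\bar x\in\mathbb{R}^d$ by choosing $l_i\in\arg\max_{l\in I_i}\alpha_l$ and setting $\bar x_i=y_i^{k_{l_i}}$ for $i=1,\dots,n$, and let $q=|\{i\in\{1,\dots,n\}:|I_i|>1\}|$. Then $$\sum_{i=1}^nf_i(\bar x_i)\le v^*+\frac{2D_{\mathcal C}}{\sqrt{K+1}}+\Big(\frac{q(m+1)}{q+(m+1)}+\frac{\|\theta\|_\infty}{\xi}\Big)\max_i\gamma(f_i),$$ $$\Big\|\sum_{i=1}^nA_i\bar x_i-b\Big\|_+\le\frac{2D_{\mathcal C}}{\sqrt{K+1}}.$$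
   Context: Setting. For $i=1,\dots,n$, $f_i:\mathbb{R}^{d_i}\to\mathbb{R}\cup\{+\infty\}$ is proper, lower semicontinuous, has an affine minorant, and $X_i=\operatorname{dom}f_i$ is compact (neither $f_i$ nor $X_i$ is assumed convex). $A_i\in\mathbb{R}^{m\times d_i}$, $b\in\mathbb{R}^m$, $d=\sum_id_i$, $A=[A_1\cdots A_n]$. Vector inequalities are componentwise. $f_i^{**}$ is the Fenchel biconjugate, with $\operatorname{dom}f_i^{**}=\operatorname{conv}X_i$. For a vector $x$, $\|x\|_+=\sqrt{\sum_j\max(x_j,0)^2}$; $\|\cdot\|$ is the Euclidean norm. $\Delta_K=\{\gamma\in\mathbb{R}^K_+:\sum_k\gamma_k=1\}$. Define $\gamma(f_i)=\sup_{x\in X_i}f_i(x)-\inf_{y\in X_i}f_i(y)$. Dual value: $\Psi(\lambda)=\inf_{x_i\in X_i}\{\sum_if_i(x_i)+\lambda^\top(\sum_iA_ix_i-b)\}$ and $v^*=\max_{\lambda\ge0}\Psi(\lambda)$. Strong duality is assumed: $v^*$ equals the optimal value of the problem of minimizing $\sum_if_i^{**}(x_i)$ subject to $Ax\le b$, $x_i\in\operatorname{conv}X_i$; and likewise for the problem with $b$ replaced by $b-\theta$. Sets: $\mathcal C_i=\{(f_i^{**}(x_i),A_ix_i):x_i\in\operatorname{conv}X_i\}\subset\mathbb{R}^{1+m}$, $\mathcal C=\sum_i\mathcal C_i$ (Minkowski sum), $D_{\mathcal C}=\sup_{z,z'\in\mathcal C}\|z-z'\|$. Frank-Wolfe stage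 with target $z^*\in\mathbb{R}^{1+m}$. Start from $z^0=\sum_i(f_i(y_i),A_iy_i)$ for some $y_i\in X_i$ with $f_i(y_i)=f_i^{**}(y_i)$. For $k=0,\dots,K-1$: let $v^k=\max(z^k-z^*,0)$ componentwise, written $v^k=(\alpha_k,g^k)\in\mathbb{R}\times\mathbb{R}^m$; for each $i$ choose $y_i^k\in\arg\min_{x_i\in\operatorname{conv}X_i}\{\alpha_kf_i^{**}(x_i)+(g^k)^\top A_ix_i\}$, chosen so that $y_i^k\in X_i$ and $f_i(y_i^k)=f_i^{**}(y_i^k)$ (this choice is a standing assumption); set $s^k=\sum_i(f_i(y_i^k),A_iy_i^k)$ and $z^{k+1}=(1-\eta_k)z^k+\eta_ks^k$, where either $\eta_k=\frac{2}{k+2}$ for all $k$, or $\eta_k=\min\big(1,\frac{(v^k)^\top(z^k-s^k)}{\|z^k-s^k\|^2}\big)$ for all $k$ (any value in $[0,1]$ if $z^k=s^k$). The output is written $z^K=\sum_{k=0}^{K-1}\gamma_ks^k$ with $\gamma\in\Delta_K$ (this representation is part of the setting). Trimming stage. Let $w^K=(z^K,\mathbf 1_n)\in\mathbb{R}^{1+m+n}$, so $w^K=\sum_k\gamma_k\sum_i(f_i(y_i^k),A_iy_i^k,e_i)$ with $e_i$ the canonical basis of $\mathbb{R}^n$. An exact conic Carathéodory algorithm returns $\alpha\in\mathbb{R}^{n+m+1}_+$ and pairs $(i_l,k_l)\in\{1,\dots,n\}\times\{0,\dots,K-1\}$, $l=1,\dots,n+m+1$, with $$w^K=\sum_{l=1}^{n+m+1}\alpha_l\,\big(f_{i_l}(y_{i_l}^{k_l}),\,A_{i_l}y_{i_l}^{k_l},\,e_{i_l}\big).$$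 Set $I_i=\{l:i_l=i\}$. *)

theory Defs
  imports "HOL-Analysis.Analysis"
begin

text \<open>
  The product space \<open>R^d = R^{d_1} \<times> \<dots> \<times> R^{d_n}\<close> is \<open>real ^ 'd\<close> together with a map
  \<open>p :: 'd \<Rightarrow> 'n\<close> that assigns each coordinate to its block, so \<open>d_i\<close> is the number of \<open>j\<close> with
  \<open>p j = i\<close>. The factor \<open>R^{d_i}\<close> is the coordinate subspace \<open>blk_space p i\<close>, and the
  \<open>i\<close>-th component \<open>x_i\<close> of \<open>x\<close> is \<open>blk p i x\<close>. The values of \<open>f i\<close> outside \<open>blk_space p i\<close>
  are never used.
\<close>

definition blk_space :: "('d::finite \<Rightarrow> 'n) \<Rightarrow> 'n \<Rightarrow> (real ^ 'd) set" where
  "blk_space p i = {x. \<forall>j. p j \<noteq> i \<longrightarrow> x $ j = 0}"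

definition blk :: "('d::finite \<Rightarrow> 'n) \<Rightarrow> 'n \<Rightarrow> real ^ 'd \<Rightarrow> real ^ 'd" where
  "blk p i x = (\<chi> j. if p j = i then x $ j else 0)"

text \<open>The submatrix \<open>A_i\<close> of \<open>A = [A_1 \<dots> A_n]\<close>, padded with zero columns.\<close>

definition blk_mat :: "('d::finite \<Rightarrow> 'n) \<Rightarrow> real ^ 'd ^ 'm \<Rightarrow> 'n \<Rightarrow> real ^ 'd ^ 'm" where
  "blk_mat p A i = (\<chi> k j. if p j = i then A $ k $ j else 0)"


definition eff_dom :: "('a set) \<Rightarrow> ('a \<Rightarrow> ereal) \<Rightarrow> 'a set" where
  "eff_dom V f = {x \<in> V. f x < \<infinity>}"

definition proper_on :: "'a set \<Rightarrow> ('a \<Rightarrow> ereal) \<Rightarrow> bool" where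
  "proper_on V f \<longleftrightarrow> (\<forall>x\<in>V. f x \<noteq> -\<infinity>) \<and> (\<exists>x\<in>V. f x \<noteq> \<infinity>)"

definition lsc_on :: "'a::topological_space set \<Rightarrow> ('a \<Rightarrow> ereal) \<Rightarrow> bool" where
  "lsc_on V f \<longleftrightarrow> (\<forall>x\<in>V. f x \<le> Liminf (at x within V) f)"

definition has_affine_minorant :: "'a::real_inner set \<Rightarrow> ('a \<Rightarrow> ereal) \<Rightarrow> bool" where
  "has_affine_minorant V f \<longleftrightarrow> (\<exists>a\<in>V. \<exists>c. \<forall>x\<in>V. ereal (a \<bullet> x + c) \<le> f x)"

text \<open>Fenchel conjugate and biconjugate within the Euclidean space \<open>V\<close> (a subspace).\<close>

definition fconj :: "'a::real_inner set \<Rightarrow> ('a \<Rightarrow> ereal) \<Rightarrow> 'a \<Rightarrow> ereal" where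
  "fconj V f s = (SUP x\<in>V. ereal (s \<bullet> x) - f x)"

definition biconj :: "'a::real_inner set \<Rightarrow> ('a \<Rightarrow> ereal) \<Rightarrow> 'a \<Rightarrow> ereal" where
  "biconj V f = fconj V (fconj V f)"


definition domX :: "('d::finite \<Rightarrow> 'n) \<Rightarrow> ('n \<Rightarrow> real ^ 'd \<Rightarrow> ereal) \<Rightarrow> 'n \<Rightarrow> (real ^ 'd) set" where
  "domX p f i = eff_dom (blk_space p i) (f i)"

definition fbb :: "('d::finite \<Rightarrow> 'n) \<Rightarrow> ('n \<Rightarrow> real ^ 'd \<Rightarrow> ereal) \<Rightarrow> 'n \<Rightarrow> real ^ 'd \<Rightarrow> ereal" where
  "fbb p f i = biconj (blk_space p i) (f i)"

text \<open>\<open>\<gamma>(f_i)\<close>; it is \<open>\<infinity>\<close> if \<open>f_i\<close> is unbounded above on its domain.\<close>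

definition gap :: "('d::finite \<Rightarrow> 'n) \<Rightarrow> ('n \<Rightarrow> real ^ 'd \<Rightarrow> ereal) \<Rightarrow> 'n \<Rightarrow> ereal" where
  "gap p f i = (SUP x\<in>domX p f i. f i x) - (INF y\<in>domX p f i. f i y)"


definition dual_fun ::
  "('d::finite \<Rightarrow> 'n::finite) \<Rightarrow> ('n \<Rightarrow> real ^ 'd \<Rightarrow> ereal) \<Rightarrow> real ^ 'd ^ 'm \<Rightarrow> real ^ 'm \<Rightarrow> real ^ 'm \<Rightarrow> ereal" where
  "dual_fun p f A b \<mu> =
     (INF x\<in>{x. \<forall>i. blk p i x \<in> domX p f i}.
        (\<Sum>i\<in>UNIV. f i (blk p i x)) +
        ereal (\<mu> \<bullet> ((\<Sum>i\<in>UNIV. blk_mat p A i *v blk p i x) - b)))"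

definition dual_value ::
  "('d::finite \<Rightarrow> 'n::finite) \<Rightarrow> ('n \<Rightarrow> real ^ 'd \<Rightarrow> ereal) \<Rightarrow> real ^ 'd ^ 'm \<Rightarrow> real ^ 'm \<Rightarrow> ereal" where
  "dual_value p f A b = (SUP \<mu>\<in>{\<mu>. 0 \<le> \<mu>}. dual_fun p f A b \<mu>)"

definition relaxed_value ::
  "('d::finite \<Rightarrow> 'n::finite) \<Rightarrow> ('n \<Rightarrow> real ^ 'd \<Rightarrow> ereal) \<Rightarrow> real ^ 'd ^ 'm \<Rightarrow> real ^ 'm \<Rightarrow> ereal" where
  "relaxed_value p f A b =
     (INF x\<in>{x. A *v x \<le> b \<and> (\<forall>i. blk p i x \<in> convex hull (domX p f i))}.
        \<Sum>i\<in>UNIV. fbb p f i (blk p i x))"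

text \<open>The first conjunct says that the supremum in \<^const>\<open>dual_value\<close> is a maximum.\<close>

definition strong_duality ::
  "('d::finite \<Rightarrow> 'n::finite) \<Rightarrow> ('n \<Rightarrow> real ^ 'd \<Rightarrow> ereal) \<Rightarrow> real ^ 'd ^ 'm \<Rightarrow> real ^ 'm \<Rightarrow> bool" where
  "strong_duality p f A b \<longleftrightarrow>
     (\<exists>\<mu>\<ge>0. dual_fun p f A b \<mu> = dual_value p f A b) \<and>
     dual_value p f A b = relaxed_value p f A b"


text \<open>
  \<open>R^{1+m}\<close> is \<open>real \<times> (real ^ 'm)\<close>, with its Euclidean norm. Both \<open>f_i\<close> on \<open>X_i\<close> and \<open>f_i^{**}\<close>
  on \<open>conv X_i\<close> are finite, so nothing is lost in \<^const>\<open>real_of_ereal\<close>.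
\<close>

definition point ::
  "('d::finite \<Rightarrow> 'n) \<Rightarrow> real ^ 'd ^ 'm \<Rightarrow> ('n \<Rightarrow> real ^ 'd \<Rightarrow> ereal) \<Rightarrow> 'n \<Rightarrow> real ^ 'd \<Rightarrow> real \<times> (real ^ 'm)" where
  "point p A h i x = (real_of_ereal (h i x), blk_mat p A i *v x)"

definition C_blk ::
  "('d::finite \<Rightarrow> 'n) \<Rightarrow> ('n \<Rightarrow> real ^ 'd \<Rightarrow> ereal) \<Rightarrow> real ^ 'd ^ 'm \<Rightarrow> 'n \<Rightarrow> (real \<times> (real ^ 'm)) set" where
  "C_blk p f A i = point p A (fbb p f) i ` (convex hull (domX p f i))"

text \<open>The sum below is the Minkowski sum of sets.\<close>

definition C_sum ::
  "('d::finite \<Rightarrow> 'n::finite) \<Rightarrow> ('n \<Rightarrow> real ^ 'd \<Rightarrow> ereal) \<Rightarrow> real ^ 'd ^ 'm \<Rightarrow> (real \<times> (real ^ 'm)) set" where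
  "C_sum p f A = (\<Sum>i\<in>UNIV. C_blk p f A i)"

definition D_C ::
  "('d::finite \<Rightarrow> 'n::finite) \<Rightarrow> ('n \<Rightarrow> real ^ 'd \<Rightarrow> ereal) \<Rightarrow> real ^ 'd ^ 'm \<Rightarrow> ereal" where
  "D_C p f A = (SUP z\<in>C_sum p f A. SUP z'\<in>C_sum p f A. ereal (norm (z - z')))"

definition pos_norm :: "real ^ 'm \<Rightarrow> real" where
  "pos_norm x = sqrt (\<Sum>j\<in>UNIV. (max (x $ j) 0)\<^sup>2)"

definition pos_part :: "real \<times> (real ^ 'm) \<Rightarrow> real \<times> (real ^ 'm)" where
  "pos_part z = (max (fst z) 0, \<chi> j. max (snd z $ j) 0)"

definition theta ::
  "('d::finite \<Rightarrow> 'n::finite) \<Rightarrow> ('n \<Rightarrow> real ^ 'd \<Rightarrow> ereal) \<Rightarrow> real ^ 'd ^ 'm \<Rightarrow> real ^ 'm" where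
  "theta p f A = (\<chi> k. (real CARD('m) + 1) *
     (MAX i\<in>UNIV. (SUP x\<in>domX p f i. row k (blk_mat p A i) \<bullet> x) - (INF x\<in>domX p f i. row k (blk_mat p A i) \<bullet> x)))"


definition fw_dir ::
  "('d::finite \<Rightarrow> 'n::finite) \<Rightarrow> ('n \<Rightarrow> real ^ 'd \<Rightarrow> ereal) \<Rightarrow> real ^ 'd ^ 'm \<Rightarrow> ('n \<Rightarrow> real ^ 'd) \<Rightarrow> real \<times> (real ^ 'm)" where
  "fw_dir p f A y = (\<Sum>i\<in>UNIV. point p A f i (y i))"

definition fw_oracle ::
  "('d::finite \<Rightarrow> 'n::finite) \<Rightarrow> ('n \<Rightarrow> real ^ 'd \<Rightarrow> ereal) \<Rightarrow> real ^ 'd ^ 'm \<Rightarrow> real \<times> (real ^ 'm) \<Rightarrow> 'n \<Rightarrow> real ^ 'd \<Rightarrow> bool" where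
  "fw_oracle p f A v i y \<longleftrightarrow>
     is_arg_min (\<lambda>x. fst v * real_of_ereal (fbb p f i x) + snd v \<bullet> (blk_mat p A i *v x))
       (\<lambda>x. x \<in> convex hull (domX p f i)) y \<and>
     y \<in> domX p f i \<and> f i y = fbb p f i y"

definition open_loop :: "nat \<Rightarrow> (nat \<Rightarrow> real) \<Rightarrow> bool" where
  "open_loop K \<eta> \<longleftrightarrow> (\<forall>k<K. \<eta> k = 2 / (real k + 2))"

definition line_search ::
  "nat \<Rightarrow> (nat \<Rightarrow> 'a::real_inner) \<Rightarrow> (nat \<Rightarrow> 'a) \<Rightarrow> (nat \<Rightarrow> 'a) \<Rightarrow> (nat \<Rightarrow> real) \<Rightarrow> bool" where
  "line_search K v z s \<eta> \<longleftrightarrow>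
     (\<forall>k<K. if z k = s k then \<eta> k \<in> {0..1}
            else \<eta> k = min 1 (v k \<bullet> (z k - s k) / (norm (z k - s k))\<^sup>2))"

text \<open>
  \<open>y0\<close> is the family defining \<open>z^0\<close>, and \<open>y k i\<close> is \<open>y_i^k\<close>. Only \<open>y k\<close>, \<open>\<eta> k\<close> for \<open>k < K\<close> and
  \<open>z k\<close> for \<open>k \<le> K\<close> are constrained.
\<close>

definition fw_run ::
  "('d::finite \<Rightarrow> 'n::finite) \<Rightarrow> ('n \<Rightarrow> real ^ 'd \<Rightarrow> ereal) \<Rightarrow> real ^ 'd ^ 'm \<Rightarrow> real \<times> (real ^ 'm) \<Rightarrow> nat \<Rightarrow>
   ('n \<Rightarrow> real ^ 'd) \<Rightarrow> (nat \<Rightarrow> 'n \<Rightarrow> real ^ 'd) \<Rightarrow> (nat \<Rightarrow> real \<times> (real ^ 'm)) \<Rightarrow> (nat \<Rightarrow> real) \<Rightarrow> bool" where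
  "fw_run p f A zstar K y0 y z \<eta> \<longleftrightarrow>
     (let v = (\<lambda>k. pos_part (z k - zstar)); s = (\<lambda>k. fw_dir p f A (y k)) in
       (\<forall>i. y0 i \<in> domX p f i \<and> f i (y0 i) = fbb p f i (y0 i)) \<and>
       z 0 = fw_dir p f A y0 \<and>
       (\<forall>k<K. \<forall>i. fw_oracle p f A (v k) i (y k i)) \<and>
       (\<forall>k<K. z (Suc k) = (1 - \<eta> k) *\<^sub>R z k + \<eta> k *\<^sub>R s k) \<and>
       (open_loop K \<eta> \<or> line_search K v z s \<eta>))"

end

theory Submission
  imports Defs
begin

text \<open>
  The squared positive residual \<open>\<parallel>(z - z\<^sup>*)\<^sub>+\<parallel>\<^sup>2\<close> is a smooth function whose infimum over \<open>C\<close> is zero,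
  because near-optimal points of the perturbed relaxation are almost dominated by \<open>z\<^sup>*\<close>; Frank-Wolfe
  thus brings the residual below \<open>2 D / sqrt (K + 1)\<close>. Replacing the convex combination in block
  \<open>i\<close> by its heaviest atom costs at most the oscillation of the block times \<open>1 - 1/|I i|\<close>, and
  since the \<open>|I i|\<close> add up to \<open>n + m + 1\<close>, AM-HM bounds the total weight by
  \<open>q (m + 1) / (q + m + 1) \<le> m + 1\<close>; \<open>\<theta>\<close> absorbs this cost in the constraints. Finally, the Slater
  point bounds the 1-norm of the perturbed multiplier by \<open>max \<gamma>(f_i) / \<xi>\<close>, hence the price of \<open>\<theta>\<close>.
\<close>

section \<open>Block decomposition of vectors and matrices\<close>

lemma blk_mat_mult_nth: "(blk_mat p A i *v x) $ k = row k (blk_mat p A i) \<bullet> x"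
  by (simp add: matrix_vector_mult_def row_def inner_vec_def)

lemma sum_blk_mat_blk:
  fixes p :: "'d::finite \<Rightarrow> 'n::finite"
  shows "(\<Sum>i\<in>UNIV. blk_mat p A i *v blk p i x) = A *v x"
proof -
  have "(\<Sum>i\<in>UNIV. (blk_mat p A i *v blk p i x) $ k) = (A *v x) $ k" for k
  proof -
    have "(\<Sum>i\<in>UNIV. (blk_mat p A i *v blk p i x) $ k)
        = (\<Sum>i\<in>UNIV. \<Sum>j\<in>UNIV. if p j = i then A $ k $ j * x $ j else 0)"
      by (simp add: matrix_vector_mult_def blk_mat_def blk_def if_distrib if_distribR cong: if_cong)
    also have "\<dots> = (\<Sum>j\<in>UNIV. A $ k $ j * x $ j)"
      by (subst sum.swap) simp
    finally show ?thesis by (simp add: matrix_vector_mult_def)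
  qed
  then show ?thesis by (simp add: vec_eq_iff)
qed

lemma ex_blk_eq:
  assumes "\<And>i. w i \<in> blk_space p i"
  obtains x where "\<And>i. blk p i x = w i"
proof
  show "blk p i (\<chi> j. w (p j) $ j) = w i" for i
    using assms[of i] by (auto simp: blk_def blk_space_def vec_eq_iff)
qed

section \<open>Finiteness of the functions and of their biconjugates\<close>

lemma domX_blk_space: "x \<in> domX p f i \<Longrightarrow> x \<in> blk_space p i"
  by (simp add: domX_def eff_dom_def)

lemma domX_finite_value:
  "proper_on (blk_space p i) (f i) \<Longrightarrow> x \<in> domX p f i \<Longrightarrow> f i x = ereal (real_of_ereal (f i x))"
  by (cases "f i x") (auto simp: domX_def eff_dom_def proper_on_def)

text \<open>By Cauchy-Schwarz the affine minorant is bounded on the bounded domain. This later keeps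
  the dual function at multiplier 0 above minus infinity.\<close>

lemma domX_bounded_below:
  assumes "has_affine_minorant (blk_space p i) (f i)" "compact (domX p f i)"
  obtains L :: real where "\<And>x. x \<in> domX p f i \<Longrightarrow> ereal L \<le> f i x"
proof -
  obtain a c where ac: "\<And>x. x \<in> blk_space p i \<Longrightarrow> ereal (a \<bullet> x + c) \<le> f i x"
    using assms(1) unfolding has_affine_minorant_def by blast
  obtain B where B: "\<And>x. x \<in> domX p f i \<Longrightarrow> norm x \<le> B"
    using compact_imp_bounded[OF assms(2)] unfolding bounded_iff by blast
  have "ereal (- (norm a * B) + c) \<le> f i x" if "x \<in> domX p f i" for x
  proof -
    have "\<bar>a \<bullet> x\<bar> \<le> norm a * B"
      using Cauchy_Schwarz_ineq2[of a x] mult_left_mono[OF B[OF that], of "norm a"] by simp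
    then have "ereal (- (norm a * B) + c) \<le> ereal (a \<bullet> x + c)" by simp
    with ac[OF domX_blk_space[OF that]] show ?thesis by (rule order_trans[rotated])
  qed
  then show thesis by (rule that)
qed

text \<open>Above: the points where the biconjugate is bounded by a real number form a convex set
  containing the domain, hence its hull. Below: the conjugate at the slope \<open>a\<close> of an
  affine minorant is at most \<open>- c\<close>, so the minorant also lies below the
  biconjugate.\<close>

lemma biconj_finite:
  assumes proper: "proper_on V f" and minorant: "has_affine_minorant V f"
    and x: "x \<in> convex hull (eff_dom V f)"
  shows "biconj V f x = ereal (real_of_ereal (biconj V f x))"
proof -
  \<comment> \<open>\<open>S\<close> is the set where the biconjugate is less than infinity; in this
    additive form two bounds \<open>B\<close> and \<open>C\<close> combine under convex
    combinations.\<close>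
  define S where "S = {x. \<exists>B. \<forall>s\<in>V. ereal (s \<bullet> x) \<le> fconj V f s + ereal B}"
  have "convex S"
    unfolding convex_def
  proof (intro ballI allI impI)
    fix u v :: real and x' y' assume "x' \<in> S" "y' \<in> S" and uv: "0 \<le> u" "0 \<le> v" "u + v = 1"
    then obtain B C where B: "\<forall>s\<in>V. ereal (s \<bullet> x') \<le> fconj V f s + ereal B"
      and C: "\<forall>s\<in>V. ereal (s \<bullet> y') \<le> fconj V f s + ereal C"
      unfolding S_def by auto
    have "ereal (s \<bullet> (u *\<^sub>R x' + v *\<^sub>R y')) \<le> fconj V f s + ereal (max B C)" if "s \<in> V" for s
    proof (cases "fconj V f s")
      case (real r)
      have "s \<bullet> x' \<le> r + max B C" "s \<bullet> y' \<le> r + max B C"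
        using B[rule_format, OF that] C[rule_format, OF that] real by auto
      then have "u * (s \<bullet> x') + v * (s \<bullet> y') \<le> r + max B C"
        using uv by (intro convex_bound_le) auto
      then show ?thesis using real by (simp add: inner_add_right del: ereal_max)
    next
      case PInf
      then show ?thesis by simp
    next
      case MInf
      then show ?thesis using B[rule_format, OF that] by simp
    qed
    then show "u *\<^sub>R x' + v *\<^sub>R y' \<in> S" unfolding S_def by blast
  qed
  moreover have "eff_dom V f \<subseteq> S"
  proof
    fix y assume y: "y \<in> eff_dom V f"
    then obtain r where r: "f y = ereal r"
      using proper by (cases "f y") (auto simp: eff_dom_def proper_on_def)
    have "ereal (s \<bullet> y) \<le> fconj V f s + ereal r" if "s \<in> V" for s
    proof -
      have "ereal (s \<bullet> y) - f y \<le> fconj V f s"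
        unfolding fconj_def using y by (intro SUP_upper) (auto simp: eff_dom_def)
      then show ?thesis using r by (cases "fconj V f s") auto
    qed
    then show "y \<in> S" unfolding S_def by blast
  qed
  ultimately have "x \<in> S" using x hull_minimal by blast
  then obtain B where B: "\<And>s. s \<in> V \<Longrightarrow> ereal (s \<bullet> x) \<le> fconj V f s + ereal B"
    unfolding S_def by blast
  have upper: "biconj V f x \<le> ereal B"
    unfolding biconj_def fconj_def[of V "fconj V f"]
  proof (rule SUP_least)
    fix s assume "s \<in> V"
    from B[OF this] show "ereal (x \<bullet> s) - fconj V f s \<le> ereal B"
      by (cases "fconj V f s") (auto simp: inner_commute)
  qed
  obtain a c where a: "a \<in> V" and ac: "\<And>x. x \<in> V \<Longrightarrow> ereal (a \<bullet> x + c) \<le> f x"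
    using minorant unfolding has_affine_minorant_def by blast
  have "fconj V f a \<le> ereal (- c)"
    unfolding fconj_def
  proof (rule SUP_least)
    fix y assume "y \<in> V"
    from ac[OF this] show "ereal (a \<bullet> y) - f y \<le> ereal (- c)" by (cases "f y") auto
  qed
  then have "ereal (a \<bullet> x + c) \<le> ereal (x \<bullet> a) - fconj V f a"
    by (cases "fconj V f a") (auto simp: inner_commute)
  also have "\<dots> \<le> biconj V f x"
    unfolding biconj_def fconj_def[of V "fconj V f"] using a by (rule SUP_upper)
  finally have "ereal (a \<bullet> x + c) \<le> biconj V f x" .
  with upper show ?thesis by (cases "biconj V f x") auto
qed

lemma fbb_finite:
  assumes "proper_on (blk_space p i) (f i)" "has_affine_minorant (blk_space p i) (f i)"
    "x \<in> convex hull (domX p f i)"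
  shows "fbb p f i x = ereal (real_of_ereal (fbb p f i x))"
  using biconj_finite assms unfolding fbb_def domX_def by blast

section \<open>The squared positive residual and the Frank-Wolfe recursion\<close>

lemma power2_norm_prod_vec: "(norm z)\<^sup>2 = (fst z)\<^sup>2 + (\<Sum>j\<in>UNIV. (snd z $ j)\<^sup>2)"
  for z :: "real \<times> (real ^ 'm)"
  unfolding power2_norm_eq_inner by (simp add: inner_prod_def inner_vec_def power2_eq_square)

text \<open>Descent inequality for the smooth function |u_+|^2 with gradient 2 u_+. It holds
  coordinatewise because (a + e)_+ is at most |a_+ + e|.\<close>

lemma norm_pos_part_add:
  "(norm (pos_part (u + d)))\<^sup>2 \<le> (norm (pos_part u))\<^sup>2 + 2 * (pos_part u \<bullet> d) + (norm d)\<^sup>2"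
proof -
  have *: "(max (a + e) 0)\<^sup>2 \<le> (max a 0 + e)\<^sup>2" for a e :: real
    by (rule abs_le_square_iff[THEN iffD1]) auto
  have "(norm (pos_part (u + d)))\<^sup>2
      = (max (fst u + fst d) 0)\<^sup>2 + (\<Sum>j\<in>UNIV. (max (snd u $ j + snd d $ j) 0)\<^sup>2)"
    by (simp add: power2_norm_prod_vec pos_part_def)
  also have "\<dots> \<le> (max (fst u) 0 + fst d)\<^sup>2 + (\<Sum>j\<in>UNIV. (max (snd u $ j) 0 + snd d $ j)\<^sup>2)"
    by (intro add_mono sum_mono *)
  also have "\<dots> = (norm (pos_part u + d))\<^sup>2"
    by (simp add: power2_norm_prod_vec pos_part_def)
  also have "\<dots> = (norm (pos_part u))\<^sup>2 + 2 * (pos_part u \<bullet> d) + (norm d)\<^sup>2"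
    unfolding power2_norm_eq_inner by (simp add: inner_add_left inner_add_right inner_commute)
  finally show ?thesis .
qed

lemma inner_pos_part_self: "pos_part u \<bullet> u = (norm (pos_part u))\<^sup>2"
proof -
  have *: "max a 0 * a = max a 0 * max a 0" for a :: real by (auto simp: max_def)
  show ?thesis
    unfolding power2_norm_eq_inner by (simp add: pos_part_def inner_prod_def inner_vec_def *)
qed

text \<open>In the application \<open>N\<close> is the squared residual, \<open>g\<close> the
  Frank-Wolfe gap and \<open>r\<close> the squared length of z - s. The line search minimizes the
  quadratic bound over [0,1], so it does at least as well as the step 2/(k+2), and both rules obey
  the same recursion.\<close>

lemma fw_rate:
  fixes N g r \<eta> :: "nat \<Rightarrow> real"
  assumes step: "\<And>k. k < K \<Longrightarrow> N (Suc k) \<le> N k - 2 * \<eta> k * g k + (\<eta> k)\<^sup>2 * r k"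
    and gap: "\<And>k. k < K \<Longrightarrow> N k \<le> g k"
    and nonneg: "\<And>k. 0 \<le> N k" and r: "\<And>k. k < K \<Longrightarrow> 0 \<le> r k \<and> r k \<le> D\<^sup>2"
    and step_size: "(\<forall>k<K. \<eta> k = 2 / (real k + 2)) \<or>
      (\<forall>k<K. if r k = 0 then g k = 0 else \<eta> k = min 1 (g k / r k))"
    and K: "1 \<le> K"
  shows "N K \<le> 4 * D\<^sup>2 / (real K + 2)"
proof -
  have rec: "N (Suc k) \<le> (1 - 2 / (real k + 2)) * N k + (2 / (real k + 2))\<^sup>2 * D\<^sup>2" if k: "k < K" for k
  proof -
    define t where "t = 2 / (real k + 2)"
    have t: "0 \<le> t" "t \<le> 1" by (auto simp: t_def)
    have "N (Suc k) \<le> N k - 2 * t * g k + t\<^sup>2 * r k"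
      using step_size
    proof
      assume "\<forall>k<K. \<eta> k = 2 / (real k + 2)"
      then show ?thesis using step[OF k] k by (simp add: t_def)
    next
      assume ls: "\<forall>k<K. if r k = 0 then g k = 0 else \<eta> k = min 1 (g k / r k)"
      show ?thesis
      proof (cases "r k = 0")
        case True
        then show ?thesis using ls step[OF k] k by simp
      next
        case False
        then have rk: "0 < r k" using r[OF k] by simp
        have eta: "\<eta> k = min 1 (g k / r k)" using ls k False by simp
        have "- 2 * \<eta> k * g k + (\<eta> k)\<^sup>2 * r k \<le> - 2 * t * g k + t\<^sup>2 * r k"
        proof (cases "g k \<le> r k")
          case True
          then have e: "\<eta> k * r k = g k" using eta rk by (simp add: min_def divide_simps)
          \<comment> \<open>Here \<eta> is the unconstrained minimizer g/r, and the quadratic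
            exceeds its minimum by a square.\<close>
          have "(- 2 * t * g k + t\<^sup>2 * r k) - (- 2 * \<eta> k * g k + (\<eta> k)\<^sup>2 * r k) = r k * (t - \<eta> k)\<^sup>2"
            unfolding e[symmetric] by (simp add: power2_eq_square algebra_simps)
          then show ?thesis using rk by (smt (verit) zero_le_power2 mult_nonneg_nonneg)
        next
          case False
          then have e: "\<eta> k = 1" using eta rk by (simp add: min_def divide_simps)
          \<comment> \<open>Here the minimizer lies beyond 1 and the step is clipped; the difference
            factors into nonnegative terms.\<close>
          have "(- 2 * t * g k + t\<^sup>2 * r k) - (- 2 * g k + r k) = (1 - t) * (2 * (g k - r k) + (1 - t) * r k)"
            by (simp add: power2_eq_square algebra_simps)
          moreover have "\<dots> \<ge> 0" using t False rk by (intro mult_nonneg_nonneg add_nonneg_nonneg) auto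
          ultimately show ?thesis by (simp add: e)
        qed
        then show ?thesis using step[OF k] by linarith
      qed
    qed
    also have "\<dots> \<le> N k - t * N k + t\<^sup>2 * D\<^sup>2"
    proof -
      \<comment> \<open>Half of the decrease \<open>2 * t * g k\<close> is given up, which leaves
        the factor 1 - t of the usual recursion.\<close>
      have "t * N k \<le> t * (2 * g k)"
        using t gap[OF k] nonneg[of k] by (intro mult_left_mono) auto
      moreover have "t\<^sup>2 * r k \<le> t\<^sup>2 * D\<^sup>2" using r[OF k] by (intro mult_left_mono) auto
      ultimately show ?thesis by (simp add: algebra_simps)
    qed
    finally show ?thesis unfolding t_def by (simp add: algebra_simps)
  qed
  have "N (Suc k) \<le> 4 * D\<^sup>2 / (real (Suc k) + 2)" if "k < K" for k
    using that
  proof (induction k)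
    \<comment> \<open>The first step size is 1, so \<open>N 0\<close> drops out and the induction
      starts from \<open>N 1\<close>, bounded by D^2.\<close>
    case 0
    have "N (Suc 0) \<le> D\<^sup>2" using rec[OF 0] by simp
    then have "N (Suc 0) * 3 \<le> 4 * D\<^sup>2" using zero_le_power2[of D] by linarith
    then show ?case by (simp add: field_simps)
  next
    case (Suc k)
    \<comment> \<open>This amounts to (a + 1)(a + 3) being at most (a + 2)^2.\<close>
    have *: "a / (a + 2) * (4 / (a + 2)) + (2 / (a + 2))\<^sup>2 \<le> 4 / (a + 3)" if "1 \<le> a" for a :: real
      using that by (simp add: divide_simps power2_eq_square) (simp add: algebra_simps)
    define a where "a = real (Suc k)"
    have "N (Suc (Suc k)) \<le> (1 - 2 / (a + 2)) * N (Suc k) + (2 / (a + 2))\<^sup>2 * D\<^sup>2"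
      using rec[OF Suc.prems] by (simp add: a_def)
    also have "1 - 2 / (a + 2) = a / (a + 2)" by (simp add: a_def field_simps)
    also have "a / (a + 2) * N (Suc k) \<le> a / (a + 2) * (4 * D\<^sup>2 / (a + 2))"
      using Suc by (intro mult_left_mono) (auto simp: a_def)
    also have "a / (a + 2) * (4 * D\<^sup>2 / (a + 2)) + (2 / (a + 2))\<^sup>2 * D\<^sup>2
        = (a / (a + 2) * (4 / (a + 2)) + (2 / (a + 2))\<^sup>2) * D\<^sup>2"
      by (simp add: algebra_simps)
    also have "\<dots> \<le> 4 / (a + 3) * D\<^sup>2"
      by (intro mult_right_mono *) (auto simp: a_def)
    finally show ?case by (simp add: a_def add.commute)
  qed
  from this[of "K - 1"] K show ?thesis by simp
qed

section \<open>Rounding each block to its heaviest atom\<close>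

text \<open>Stated for an arbitrary score \<open>g\<close> on the atoms, so that it serves the
  objective and every constraint row. The oscillation bound \<open>G\<close> concerns only blocks
  with several atoms; if there are none, \<open>G\<close> is arbitrary, which covers infinite
  oscillations elsewhere.\<close>

lemma block_rounding:
  fixes I :: "'n::finite \<Rightarrow> nat set" and \<alpha> g :: "nat \<Rightarrow> real"
  assumes fin: "\<And>i. finite (I i)" and nonneg: "\<And>i l. l \<in> I i \<Longrightarrow> 0 \<le> \<alpha> l"
    and one: "\<And>i. (\<Sum>l\<in>I i. \<alpha> l) = 1"
    and lsel: "\<And>i. lsel i \<in> I i \<and> (\<forall>l\<in>I i. \<alpha> l \<le> \<alpha> (lsel i))"
    and card: "(\<Sum>i\<in>UNIV. real (card (I i))) = real CARD('n) + M" and M: "0 < M"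
    and q: "q = card {i. card (I i) > 1}"
    and osc: "\<And>i l l'. card (I i) > 1 \<Longrightarrow> l \<in> I i \<Longrightarrow> l' \<in> I i \<Longrightarrow> g l - g l' \<le> G"
  shows "(\<Sum>i\<in>UNIV. g (lsel i)) \<le> (\<Sum>i\<in>UNIV. \<Sum>l\<in>I i. \<alpha> l * g l) + real q * M / (real q + M) * G"
proof -
  define Q where "Q = {i. card (I i) > 1}"
  define c where "c i = real (card (I i))" for i
  define t where "t = real q / (real q + M)"
  have qQ: "q = card Q" by (simp add: q Q_def)
  have pos: "0 < card (I i)" for i using fin lsel by (auto simp: card_gt_0_iff)
  have diff: "g (lsel i) - (\<Sum>l\<in>I i. \<alpha> l * g l) = (\<Sum>l\<in>I i - {lsel i}. \<alpha> l * (g (lsel i) - g l))" for i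
  proof -
    have "g (lsel i) - (\<Sum>l\<in>I i. \<alpha> l * g l) = (\<Sum>l\<in>I i. \<alpha> l) * g (lsel i) - (\<Sum>l\<in>I i. \<alpha> l * g l)"
      by (simp add: one)
    also have "\<dots> = (\<Sum>l\<in>I i. \<alpha> l * (g (lsel i) - g l))"
      by (simp add: sum_distrib_right sum_subtractf right_diff_distrib)
    also have "\<dots> = (\<Sum>l\<in>I i - {lsel i}. \<alpha> l * (g (lsel i) - g l))"
      using fin lsel by (subst sum.remove[of _ "lsel i"]) auto
    finally show ?thesis .
  qed
  have single: "I i - {lsel i} = {}" if "i \<notin> Q" for i
  proof -
    have "card (I i) = 1" using that pos[of i] by (auto simp: Q_def)
    then obtain l where "I i = {l}" by (auto simp: card_1_singleton_iff)
    then show ?thesis using lsel[of i] by auto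
  qed
  have multi: "g (lsel i) - (\<Sum>l\<in>I i. \<alpha> l * g l) \<le> (1 - 1 / c i) * G" and G: "0 \<le> G" if i: "i \<in> Q" for i
  proof -
    have osc_i: "\<And>l l'. l \<in> I i \<Longrightarrow> l' \<in> I i \<Longrightarrow> g l - g l' \<le> G" using i osc by (simp add: Q_def)
    show G: "0 \<le> G" using osc_i[of "lsel i" "lsel i"] lsel by simp
    have "g (lsel i) - (\<Sum>l\<in>I i. \<alpha> l * g l) \<le> (\<Sum>l\<in>I i - {lsel i}. \<alpha> l * G)"
      unfolding diff using osc_i lsel nonneg by (intro sum_mono mult_left_mono) auto
    also have "\<dots> = (1 - \<alpha> (lsel i)) * G"
      using one[of i] fin[of i] lsel[of i] by (simp add: sum_distrib_right[symmetric] sum_diff1)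
    also have "\<dots> \<le> (1 - 1 / c i) * G"
    proof (intro mult_right_mono G)
      \<comment> \<open>The largest of \<open>c i\<close> weights with sum 1 is at least
        \<open>1 / c i\<close>.\<close>
      have "1 \<le> (\<Sum>l\<in>I i. \<alpha> (lsel i))"
        unfolding one[of i, symmetric] using lsel by (intro sum_mono) auto
      then have "1 \<le> c i * \<alpha> (lsel i)" by (simp add: c_def)
      then show "1 - \<alpha> (lsel i) \<le> 1 - 1 / c i"
        using pos[of i] by (simp add: c_def field_simps)
    qed
    finally show "g (lsel i) - (\<Sum>l\<in>I i. \<alpha> l * g l) \<le> (1 - 1 / c i) * G" .
  qed
  have csum: "(\<Sum>i\<in>Q. c i) = real q + M"
  proof -
    \<comment> \<open>Singleton blocks have excess \<open>c i - 1 = 0\<close>, so the total excess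
      \<open>M\<close> is carried by \<open>Q\<close>.\<close>
    have "(\<Sum>i\<in>UNIV. c i - 1) = (\<Sum>i\<in>Q. c i - 1)"
    proof (rule sum.mono_neutral_right)
      show "\<forall>i\<in>UNIV - Q. c i - 1 = 0"
      proof
        fix i assume "i \<in> UNIV - Q"
        then have "card (I i) = 1" using pos[of i] by (auto simp: Q_def)
        then show "c i - 1 = 0" by (simp add: c_def)
      qed
    qed auto
    moreover have "(\<Sum>i\<in>UNIV. c i - 1) = M" using card by (simp add: sum_subtractf c_def)
    ultimately show ?thesis by (simp add: sum_subtractf qQ)
  qed
  \<comment> \<open>AM-HM through the tangent line of \<open>1/x\<close> at the mean \<open>1/t\<close> of the \<open>c i\<close>\<close>
  have "(\<Sum>i\<in>Q. 1 - 1 / c i) \<le> (\<Sum>i\<in>Q. 1 - (2 * t - t\<^sup>2 * c i))"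
  proof (rule sum_mono)
    fix i
    have ci: "0 < c i" using pos[of i] by (simp add: c_def)
    have "1 / c i - (2 * t - t\<^sup>2 * c i) = (1 - t * c i)\<^sup>2 / c i"
      using ci by (simp add: field_simps power2_eq_square)
    moreover have "\<dots> \<ge> 0" using ci by simp
    ultimately show "1 - 1 / c i \<le> 1 - (2 * t - t\<^sup>2 * c i)" by linarith
  qed
  also have "\<dots> = real q - 2 * t * real q + t\<^sup>2 * (real q + M)"
    by (simp add: sum_subtractf sum_distrib_left[symmetric] csum qQ)
  also have "\<dots> = real q * M / (real q + M)"
    using M unfolding t_def by (simp add: divide_simps power2_eq_square) (simp add: algebra_simps)
  finally have weight: "(\<Sum>i\<in>Q. 1 - 1 / c i) \<le> real q * M / (real q + M)" .
  have "(\<Sum>i\<in>UNIV. g (lsel i)) - (\<Sum>i\<in>UNIV. \<Sum>l\<in>I i. \<alpha> l * g l)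
      = (\<Sum>i\<in>UNIV. g (lsel i) - (\<Sum>l\<in>I i. \<alpha> l * g l))"
    by (simp add: sum_subtractf)
  also have "\<dots> = (\<Sum>i\<in>Q. g (lsel i) - (\<Sum>l\<in>I i. \<alpha> l * g l))"
    by (rule sum.mono_neutral_right) (auto simp: diff single)
  also have "\<dots> \<le> (\<Sum>i\<in>Q. (1 - 1 / c i) * G)"
    by (intro sum_mono multi)
  also have "\<dots> = (\<Sum>i\<in>Q. 1 - 1 / c i) * G"
    by (simp add: sum_distrib_right)
  also have "\<dots> \<le> real q * M / (real q + M) * G"
  \<comment> \<open>The sign of \<open>G\<close> is known only when some block has several atoms;
    otherwise both sides are 0.\<close>
  proof (cases "Q = {}")
    case False
    then show ?thesis using G weight by (intro mult_right_mono) auto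
  qed (simp add: qQ)
  finally show ?thesis by simp
qed

section \<open>Frank-Wolfe directions as points of C\<close>

lemma fw_dir_eq_fbb:
  assumes "\<And>i. f i (y i) = fbb p f i (y i)"
  shows "fw_dir p f A y = (\<Sum>i\<in>UNIV. point p A (fbb p f) i (y i))"
  using assms by (simp add: fw_dir_def point_def)

lemma fw_dir_in_C_sum:
  assumes "\<And>i. y i \<in> domX p f i" "\<And>i. f i (y i) = fbb p f i (y i)"
  shows "fw_dir p f A y \<in> C_sum p f A"
proof -
  have "\<forall>i\<in>UNIV. point p A (fbb p f) i (y i) \<in> C_blk p f A i"
    using assms(1) by (auto simp: C_blk_def intro: hull_inc)
  then show ?thesis
    unfolding C_sum_def fw_dir_eq_fbb[of f y, OF assms(2)] set_sum_alt[OF finite] by blast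
qed

lemma norm_diff_le_D_C:
  assumes "z \<in> C_sum p f A" "z' \<in> C_sum p f A"
  shows "ereal (norm (z - z')) \<le> D_C p f A"
  unfolding D_C_def using assms by (blast intro: SUP_upper2 order_refl)

text \<open>C is a Minkowski sum, so minimizing the linear functional \<open>v\<close> over it
  splits into the block problems that the oracle solves.\<close>

lemma fw_oracle_minimal:
  fixes p :: "'d::finite \<Rightarrow> 'n::finite"
  assumes "\<And>i. fw_oracle p f A v i (y i)" "\<And>i. blk p i x \<in> convex hull (domX p f i)"
  shows "v \<bullet> fw_dir p f A y \<le> fst v * (\<Sum>i\<in>UNIV. real_of_ereal (fbb p f i (blk p i x))) + snd v \<bullet> (A *v x)"
proof -
  have "v \<bullet> point p A (fbb p f) i (y i) \<le> v \<bullet> point p A (fbb p f) i (blk p i x)" for i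
    using assms(1)[of i] assms(2)[of i]
    by (auto simp: fw_oracle_def is_arg_min_linorder point_def inner_prod_def)
  then have "v \<bullet> fw_dir p f A y \<le> (\<Sum>i\<in>UNIV. v \<bullet> point p A (fbb p f) i (blk p i x))"
    using assms(1) by (subst fw_dir_eq_fbb) (auto simp: fw_oracle_def inner_sum_right intro: sum_mono)
  also have "\<dots> = fst v * (\<Sum>i\<in>UNIV. real_of_ereal (fbb p f i (blk p i x))) + snd v \<bullet> (A *v x)"
    by (simp add: point_def inner_prod_def sum.distrib sum_distrib_left inner_sum_right
        sum_blk_mat_blk[symmetric, of A x p])
  finally show ?thesis .
qed

section \<open>Dual and relaxed values\<close>

text \<open>At multiplier 0 the constraint term vanishes. This is the source of the lower bounds on
  the dual value, both for its finiteness and for the multiplier estimate.\<close>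

lemma dual_fun_zero_ge:
  fixes p :: "'d::finite \<Rightarrow> 'n::finite"
  assumes "\<And>i x. x \<in> domX p f i \<Longrightarrow> ereal (L i) \<le> f i x"
  shows "ereal (\<Sum>i\<in>UNIV. L i) \<le> dual_fun p f A b 0"
  unfolding dual_fun_def
proof (rule INF_greatest)
  fix x assume "x \<in> {x. \<forall>i. blk p i x \<in> domX p f i}"
  then have "(\<Sum>i\<in>UNIV. ereal (L i)) \<le> (\<Sum>i\<in>UNIV. f i (blk p i x))"
    using assms by (intro sum_mono) auto
  then show "ereal (\<Sum>i\<in>UNIV. L i)
      \<le> (\<Sum>i\<in>UNIV. f i (blk p i x)) + ereal (0 \<bullet> ((\<Sum>i\<in>UNIV. blk_mat p A i *v blk p i x) - b))"
    by simp
qed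

lemma dual_fun_le_dual_value: "0 \<le> \<mu> \<Longrightarrow> dual_fun p f A b \<mu> \<le> dual_value p f A b"
  unfolding dual_value_def by (rule SUP_upper) simp

text \<open>The Frank-Wolfe target uses \<open>real_of_ereal\<close>, which sends infinities to 0,
  so finiteness matters. The bound below comes from duality at multiplier 0, the bound above from
  the feasible point.\<close>

lemma relaxed_value_finite:
  fixes p :: "'d::finite \<Rightarrow> 'n::finite"
  assumes proper: "\<And>i. proper_on (blk_space p i) (f i)"
    and minorant: "\<And>i. has_affine_minorant (blk_space p i) (f i)"
    and compact_dom: "\<And>i. compact (domX p f i)"
    and duality: "strong_duality p f A b"
    and feasible: "A *v x \<le> b" "\<And>i. blk p i x \<in> convex hull (domX p f i)"
  shows "relaxed_value p f A b = ereal (real_of_ereal (relaxed_value p f A b))"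
proof -
  have "\<forall>i. \<exists>L :: real. \<forall>x. x \<in> domX p f i \<longrightarrow> ereal L \<le> f i x"
    using domX_bounded_below[OF minorant compact_dom] by metis
  then obtain L :: "'n \<Rightarrow> real" where "\<And>i x. x \<in> domX p f i \<Longrightarrow> ereal (L i) \<le> f i x"
    by metis
  then have "ereal (\<Sum>i\<in>UNIV. L i) \<le> dual_fun p f A b 0" by (rule dual_fun_zero_ge)
  also have "\<dots> \<le> relaxed_value p f A b"
    using dual_fun_le_dual_value[of 0 p f A b] duality by (simp add: strong_duality_def)
  finally have "relaxed_value p f A b \<noteq> -\<infinity>" by auto
  moreover have "relaxed_value p f A b \<le> (\<Sum>i\<in>UNIV. fbb p f i (blk p i x))"
    unfolding relaxed_value_def using feasible by (intro INF_lower) auto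
  moreover have "\<dots> = (\<Sum>i\<in>UNIV. ereal (real_of_ereal (fbb p f i (blk p i x))))"
    by (intro sum.cong refl fbb_finite proper minorant feasible)
  ultimately show ?thesis by (cases "relaxed_value p f A b") auto
qed

text \<open>Working up to \<open>e\<close> avoids having to show that the infimum of the relaxed
  problem is attained.\<close>

lemma relaxed_near_optimal:
  fixes p :: "'d::finite \<Rightarrow> 'n::finite"
  assumes proper: "\<And>i. proper_on (blk_space p i) (f i)"
    and minorant: "\<And>i. has_affine_minorant (blk_space p i) (f i)"
    and optval: "relaxed_value p f A b = ereal u" and "0 < e"
  obtains x where "A *v x \<le> b" "\<And>i. blk p i x \<in> convex hull (domX p f i)"
    "(\<Sum>i\<in>UNIV. real_of_ereal (fbb p f i (blk p i x))) < u + e"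
proof -
  have "relaxed_value p f A b < ereal (u + e)" using assms by simp
  then obtain x where x: "A *v x \<le> b" "\<And>i. blk p i x \<in> convex hull (domX p f i)"
    and less: "(\<Sum>i\<in>UNIV. fbb p f i (blk p i x)) < ereal (u + e)"
    unfolding relaxed_value_def INF_less_iff by auto
  have "(\<Sum>i\<in>UNIV. fbb p f i (blk p i x)) = (\<Sum>i\<in>UNIV. ereal (real_of_ereal (fbb p f i (blk p i x))))"
    by (intro sum.cong refl fbb_finite proper minorant x)
  with less x show thesis by (intro that) auto
qed

section \<open>The Frank-Wolfe residual bound\<close>

lemma fw_gap_lower_bound:
  fixes p :: "'d::finite \<Rightarrow> 'n::finite"
  assumes proper: "\<And>i. proper_on (blk_space p i) (f i)"
    and minorant: "\<And>i. has_affine_minorant (blk_space p i) (f i)"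
    and optval: "relaxed_value p f A b = ereal u"
    and minimizer: "\<And>i. fw_oracle p f A (pos_part (z - (u, b))) i (y i)"
  shows "(norm (pos_part (z - (u, b))))\<^sup>2 \<le> pos_part (z - (u, b)) \<bullet> (z - fw_dir p f A y)"
proof -
  define v where "v = pos_part (z - (u, b))"
  have v_nonneg: "0 \<le> fst v" "\<And>j. 0 \<le> snd v $ j" by (auto simp: v_def pos_part_def)
  have approx: "v \<bullet> fw_dir p f A y \<le> v \<bullet> (u, b) + fst v * e" if e: "0 < e" for e
  proof -
    obtain x where x: "A *v x \<le> b" "\<And>i. blk p i x \<in> convex hull (domX p f i)"
      "(\<Sum>i\<in>UNIV. real_of_ereal (fbb p f i (blk p i x))) < u + e"
      using relaxed_near_optimal[OF proper minorant optval e] by blast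
    have "v \<bullet> fw_dir p f A y
        \<le> fst v * (\<Sum>i\<in>UNIV. real_of_ereal (fbb p f i (blk p i x))) + snd v \<bullet> (A *v x)"
      using minimizer x(2) by (intro fw_oracle_minimal) (auto simp: v_def)
    also have "\<dots> \<le> fst v * (u + e) + snd v \<bullet> b"
    proof (intro add_mono mult_left_mono)
      show "snd v \<bullet> (A *v x) \<le> snd v \<bullet> b"
        using x(1) v_nonneg unfolding inner_vec_def less_eq_vec_def
        by (auto intro!: sum_mono mult_left_mono)
    qed (use x(3) v_nonneg in auto)
    finally show ?thesis by (simp add: inner_prod_def algebra_simps)
  qed
  have "v \<bullet> fw_dir p f A y \<le> v \<bullet> (u, b)"
  \<comment> \<open>The error term is \<open>fst v * e\<close>: it vanishes, or \<open>e\<close> is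
    rescaled by \<open>fst v\<close>.\<close>
  proof (cases "fst v = 0")
    case True
    then show ?thesis using approx[of 1] by simp
  next
    case False
    have "v \<bullet> fw_dir p f A y \<le> v \<bullet> (u, b) + e" if "0 < e" for e
      using approx[of "e / fst v"] False v_nonneg that by simp
    then show ?thesis by (rule field_le_epsilon)
  qed
  moreover have "(norm v)\<^sup>2 = v \<bullet> z - v \<bullet> (u, b)"
    using inner_pos_part_self[of "z - (u, b)"] by (simp add: v_def inner_diff_right)
  ultimately show ?thesis by (simp add: v_def inner_diff_right)
qed

text \<open>The descent inequality along z - s, the gap bound and the diameter \<open>D\<close> are
  exactly the inputs of \<open>fw_rate\<close>.\<close>

lemma fw_residual_bound:
  fixes p :: "'d::finite \<Rightarrow> 'n::finite"
  assumes proper: "\<And>i. proper_on (blk_space p i) (f i)"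
    and minorant: "\<And>i. has_affine_minorant (blk_space p i) (f i)"
    and optval: "relaxed_value p f A b = ereal u"
    and run: "fw_run p f A (u, b) K y0 y z \<eta>" and K: "1 \<le> K"
    and D: "D_C p f A = ereal D"
  shows "norm (pos_part (z K - (u, b))) \<le> 2 * D / sqrt (real K + 1)"
proof -
  define v where "v k = pos_part (z k - (u, b))" for k
  define s where "s k = fw_dir p f A (y k)" for k
  have z0: "z 0 = fw_dir p f A y0" and y0: "\<And>i. y0 i \<in> domX p f i" "\<And>i. f i (y0 i) = fbb p f i (y0 i)"
    and minimizer: "\<And>k i. k < K \<Longrightarrow> fw_oracle p f A (v k) i (y k i)"
    and step: "\<And>k. k < K \<Longrightarrow> z (Suc k) = (1 - \<eta> k) *\<^sub>R z k + \<eta> k *\<^sub>R s k"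
    and size: "open_loop K \<eta> \<or> line_search K v z s \<eta>"
    using run unfolding fw_run_def Let_def v_def s_def by auto
  have gap: "(norm (v k))\<^sup>2 \<le> v k \<bullet> (z k - s k)" if "k < K" for k
    unfolding v_def s_def
    by (rule fw_gap_lower_bound[OF proper minorant optval]) (use minimizer[OF that] in \<open>simp add: v_def\<close>)
  have eta: "0 \<le> \<eta> k \<and> \<eta> k \<le> 1" if k: "k < K" for k
    using size
  proof
    assume "open_loop K \<eta>"
    then show ?thesis using k by (simp add: open_loop_def)
  next
    assume "line_search K v z s \<eta>"
    then have "if z k = s k then \<eta> k \<in> {0..1}
        else \<eta> k = min 1 (v k \<bullet> (z k - s k) / (norm (z k - s k))\<^sup>2)"
      using k unfolding line_search_def by blast
    \<comment> \<open>The line-search formula clips only at 1; nonnegativity of the step comes from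
      the gap bound.\<close>
    moreover have "0 \<le> v k \<bullet> (z k - s k)" using gap[OF k] by (rule order_trans[rotated]) simp
    ultimately show ?thesis by (auto split: if_splits)
  qed
  have sC: "s k \<in> C_sum p f A" if "k < K" for k
    unfolding s_def using minimizer[OF that] by (intro fw_dir_in_C_sum) (auto simp: fw_oracle_def)
  have zC: "z k \<in> convex hull (C_sum p f A)" if "k \<le> K" for k
    using that
  proof (induction k)
    case 0
    show ?case unfolding z0 using y0 by (intro hull_inc fw_dir_in_C_sum)
  next
    case (Suc k)
    then show ?case
      using step[of k] eta[of k] hull_inc[OF sC[of k]]
      by (auto intro!: convexD[OF convex_convex_hull])
  qed
  have dist: "norm (z k - s k) \<le> D" if k: "k < K" for k
  proof -
    \<comment> \<open>The iterates are only known to lie in the hull of C. The ball of radius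
      \<open>D\<close> about \<open>s k\<close> is convex and contains C, hence contains the
      hull.\<close>
    have "C_sum p f A \<subseteq> cball (s k) D"
    proof
      fix c assume "c \<in> C_sum p f A"
      from norm_diff_le_D_C[OF sC[OF k] this] show "c \<in> cball (s k) D"
        by (simp add: D dist_norm)
    qed
    then have "convex hull (C_sum p f A) \<subseteq> cball (s k) D" by (rule hull_minimal) simp
    with zC[of k] k show ?thesis by (auto simp: dist_norm norm_minus_commute)
  qed
  have D0: "0 \<le> D" using dist[of 0] K norm_ge_zero[of "z 0 - s 0"] by linarith
  have descent: "(norm (v (Suc k)))\<^sup>2
      \<le> (norm (v k))\<^sup>2 - 2 * \<eta> k * (v k \<bullet> (z k - s k)) + (\<eta> k)\<^sup>2 * (norm (z k - s k))\<^sup>2"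
    if k: "k < K" for k
  proof -
    have "v (Suc k) = pos_part ((z k - (u, b)) + - \<eta> k *\<^sub>R (z k - s k))"
      by (simp add: v_def step[OF k] algebra_simps)
    then show ?thesis
      using norm_pos_part_add[of "z k - (u, b)" "- \<eta> k *\<^sub>R (z k - s k)"]
      by (simp add: v_def power_mult_distrib mult.assoc)
  qed
  have "(norm (v K))\<^sup>2 \<le> 4 * D\<^sup>2 / (real K + 2)"
  proof (rule fw_rate[where N = "\<lambda>k. (norm (v k))\<^sup>2" and \<eta> = \<eta>
        and g = "\<lambda>k. v k \<bullet> (z k - s k)" and r = "\<lambda>k. (norm (z k - s k))\<^sup>2"])
    show "(\<forall>k<K. \<eta> k = 2 / (real k + 2)) \<or>
        (\<forall>k<K. if (norm (z k - s k))\<^sup>2 = 0 then v k \<bullet> (z k - s k) = 0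
               else \<eta> k = min 1 (v k \<bullet> (z k - s k) / (norm (z k - s k))\<^sup>2))"
      using size unfolding open_loop_def line_search_def by auto
  qed (use descent gap K dist in \<open>auto intro: power_mono\<close>)
  \<comment> \<open>K + 2 is relaxed to K + 1 to match the claimed bound.\<close>
  also have "\<dots> \<le> 4 * D\<^sup>2 / (real K + 1)" by (intro divide_left_mono) auto
  also have "\<dots> = (2 * D / sqrt (real K + 1))\<^sup>2" by (simp add: power_divide power_mult_distrib)
  finally show ?thesis
    unfolding v_def by (rule power2_le_imp_le) (use D0 in auto)
qed

section \<open>Lagrange multipliers and the price of \<theta>\<close>

lemma gap_ge_diff:
  assumes "x \<in> domX p f i" "x' \<in> domX p f i"
  shows "f i x - f i x' \<le> gap p f i"
  unfolding gap_def using assms by (intro ereal_minus_mono SUP_upper INF_lower)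

text \<open>Otherwise the hull would lie in an open half-space that excludes \<open>x\<close>. This
  replaces the Slater point, which lies in the hull, by points of the domain itself.\<close>

lemma ex_inner_le_of_convex_hull:
  assumes "x \<in> convex hull S"
  obtains w where "w \<in> S" "a \<bullet> w \<le> a \<bullet> x"
proof -
  have False if "\<forall>w\<in>S. a \<bullet> x < a \<bullet> w"
  proof -
    have "convex hull S \<subseteq> {w. a \<bullet> w > a \<bullet> x}"
      using that by (intro hull_minimal convex_halfspace_gt) auto
    with assms show False by auto
  qed
  then show thesis using that by (meson not_less)
qed

text \<open>Independent choices in the blocks glue to one vector, since the blocks occupy disjoint
  coordinates.\<close>

lemma dual_fun_le_point:
  fixes p :: "'d::finite \<Rightarrow> 'n::finite"
  assumes w: "\<And>i. w i \<in> domX p f i"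
  shows "dual_fun p f A b \<mu>
     \<le> (\<Sum>i\<in>UNIV. f i (w i)) + ereal (\<mu> \<bullet> ((\<Sum>i\<in>UNIV. blk_mat p A i *v w i) - b))"
proof -
  obtain x where x: "\<And>i. blk p i x = w i"
    using ex_blk_eq[of w p] domX_blk_space[OF w] by metis
  show ?thesis
    unfolding dual_fun_def by (rule INF_lower2[of x]) (auto simp: x w)
qed

text \<open>Replacing b - \<theta> by b lowers every Lagrangian value at \<mu> by the same constant
  \<mu> . \<theta>.\<close>

lemma dual_shift:
  fixes p :: "'d::finite \<Rightarrow> 'n::finite"
  assumes \<mu>: "0 \<le> \<mu>" and u: "dual_fun p f A (b - \<theta>) \<mu> = ereal u"
  shows "ereal (u - \<mu> \<bullet> \<theta>) \<le> dual_value p f A b"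
proof (rule order_trans[OF _ dual_fun_le_dual_value[OF \<mu>]], unfold dual_fun_def, rule INF_greatest)
  fix x assume x: "x \<in> {x. \<forall>i. blk p i x \<in> domX p f i}"
  have "ereal u \<le> (\<Sum>i\<in>UNIV. f i (blk p i x))
      + ereal (\<mu> \<bullet> ((\<Sum>i\<in>UNIV. blk_mat p A i *v blk p i x) - (b - \<theta>)))"
    unfolding u[symmetric] using x by (intro dual_fun_le_point) auto
  then show "ereal (u - \<mu> \<bullet> \<theta>) \<le> (\<Sum>i\<in>UNIV. f i (blk p i x))
      + ereal (\<mu> \<bullet> ((\<Sum>i\<in>UNIV. blk_mat p A i *v blk p i x) - b))"
    by (cases "\<Sum>i\<in>UNIV. f i (blk p i x)") (auto simp: inner_diff_right)
qed

text \<open>Classical Slater estimate: the dual value is at least its value at 0, hence at least the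
  sum of \<open>W\<close> minus n G, while evaluating the Lagrangian at \<mu> and \<open>w\<close>
  bounds it by the sum of \<open>W\<close> minus n \<xi> |\<mu>|_1. The sum of \<open>W\<close> and
  the factor n cancel.\<close>

lemma multiplier_bound:
  fixes p :: "'d::finite \<Rightarrow> 'n::finite" and \<mu> b :: "real ^ 'm"
  assumes proper: "\<And>i. proper_on (blk_space p i) (f i)"
    and minorant: "\<And>i. has_affine_minorant (blk_space p i) (f i)"
    and compact_dom: "\<And>i. compact (domX p f i)"
    and \<mu>: "0 \<le> \<mu>" and opt: "dual_fun p f A b \<mu> = dual_value p f A b"
    and fin: "dual_value p f A b = ereal u"
    and xhat: "\<And>i. blk p i xhat \<in> convex hull (domX p f i)"
    and slater: "(\<Sum>i\<in>UNIV. blk_mat p A i *v blk p i xhat) \<le> b - (real CARD('n) * \<xi>) *\<^sub>R 1"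
    and G: "\<And>i. gap p f i \<le> ereal G"
  shows "\<xi> * (\<Sum>j\<in>UNIV. \<mu> $ j) \<le> G"
proof -
  \<comment> \<open>The functional is the transpose of A_i applied to \<mu>, so passing from the
    Slater point to \<open>w\<close> does not increase the \<mu>-weighted constraint.\<close>
  have "\<forall>i. \<exists>w. w \<in> domX p f i \<and> (\<mu> v* blk_mat p A i) \<bullet> w \<le> (\<mu> v* blk_mat p A i) \<bullet> blk p i xhat"
    using ex_inner_le_of_convex_hull[OF xhat] by metis
  then obtain w where w: "\<And>i. w i \<in> domX p f i"
    and w_le: "\<And>i. (\<mu> v* blk_mat p A i) \<bullet> w i \<le> (\<mu> v* blk_mat p A i) \<bullet> blk p i xhat"
    by metis
  define W where "W i = real_of_ereal (f i (w i))" for i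
  have W: "f i (w i) = ereal (W i)" for i
    unfolding W_def by (rule domX_finite_value[OF proper w])
  have "ereal (W i - G) \<le> f i x" if "x \<in> domX p f i" for i x
  proof -
    have "f i (w i) - f i x \<le> ereal G"
      using gap_ge_diff[of "w i" p f i x, OF w that] G[of i] by (rule order_trans)
    then show ?thesis by (cases "f i x") (auto simp: W)
  qed
  then have "ereal (\<Sum>i\<in>UNIV. W i - G) \<le> dual_fun p f A b 0" by (rule dual_fun_zero_ge)
  also have "\<dots> \<le> ereal u" unfolding fin[symmetric] by (rule dual_fun_le_dual_value) simp
  finally have lower: "(\<Sum>i\<in>UNIV. W i) - real CARD('n) * G \<le> u" by (simp add: sum_subtractf)
  have "ereal u \<le> ereal ((\<Sum>i\<in>UNIV. W i) + \<mu> \<bullet> ((\<Sum>i\<in>UNIV. blk_mat p A i *v w i) - b))"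
    using dual_fun_le_point[of w p f A b \<mu>, OF w] by (simp add: opt fin W)
  then have upper: "u \<le> (\<Sum>i\<in>UNIV. W i) + \<mu> \<bullet> ((\<Sum>i\<in>UNIV. blk_mat p A i *v w i) - b)" by simp
  have "\<mu> \<bullet> (\<Sum>i\<in>UNIV. blk_mat p A i *v w i) \<le> \<mu> \<bullet> (\<Sum>i\<in>UNIV. blk_mat p A i *v blk p i xhat)"
    using w_le by (simp add: inner_sum_right dot_lmul_matrix sum_mono)
  also have "\<dots> \<le> \<mu> \<bullet> (b - (real CARD('n) * \<xi>) *\<^sub>R 1)"
    using slater \<mu> unfolding inner_vec_def less_eq_vec_def
    by (auto intro!: sum_mono mult_left_mono)
  also have "\<dots> = \<mu> \<bullet> b - real CARD('n) * \<xi> * (\<Sum>j\<in>UNIV. \<mu> $ j)"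
    by (simp add: inner_diff_right) (simp add: inner_vec_def)
  finally have "u \<le> (\<Sum>i\<in>UNIV. W i) - real CARD('n) * \<xi> * (\<Sum>j\<in>UNIV. \<mu> $ j)"
    using upper by (simp add: inner_diff_right)
  with lower have "real CARD('n) * (\<xi> * (\<Sum>j\<in>UNIV. \<mu> $ j)) \<le> real CARD('n) * G"
    by linarith
  then show ?thesis by simp
qed

lemma abs_nth_le_infnorm: "\<bar>x $ j\<bar> \<le> infnorm x" for x :: "real ^ 'm"
  using Basis_le_infnorm[of "axis j 1" x] by (simp add: inner_axis)

text \<open>The optimal multiplier of the perturbed problem is a candidate for the original dual,
  and \<mu> . \<theta> is at most |\<mu>|_1 times the sup norm of \<theta>. For \<theta> = 0 the
  price is 0, so \<open>G\<close> is then left arbitrary.\<close>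

lemma perturbation_bound:
  fixes p :: "'d::finite \<Rightarrow> 'n::finite" and b \<theta> :: "real ^ 'm"
  assumes proper: "\<And>i. proper_on (blk_space p i) (f i)"
    and minorant: "\<And>i. has_affine_minorant (blk_space p i) (f i)"
    and compact_dom: "\<And>i. compact (domX p f i)"
    and duality: "strong_duality p f A (b - \<theta>)"
    and optval: "relaxed_value p f A (b - \<theta>) = ereal u"
    and xi: "0 < \<xi>"
    and xhat: "\<And>i. blk p i xhat \<in> convex hull (domX p f i)"
    and slater: "(\<Sum>i\<in>UNIV. blk_mat p A i *v blk p i xhat) \<le> b - \<theta> - (real CARD('n) * \<xi>) *\<^sub>R 1"
    and G: "\<theta> \<noteq> 0 \<Longrightarrow> (\<And>i. gap p f i \<le> ereal G)"
  shows "ereal (u - infnorm \<theta> / \<xi> * G) \<le> dual_value p f A b"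
proof -
  obtain \<mu> where \<mu>: "0 \<le> \<mu>" and opt: "dual_fun p f A (b - \<theta>) \<mu> = dual_value p f A (b - \<theta>)"
    using duality unfolding strong_duality_def by blast
  have fin: "dual_value p f A (b - \<theta>) = ereal u"
    using duality optval by (simp add: strong_duality_def)
  have shift: "ereal (u - \<mu> \<bullet> \<theta>) \<le> dual_value p f A b"
    using opt fin by (intro dual_shift \<mu>) simp
  have "\<mu> \<bullet> \<theta> \<le> infnorm \<theta> / \<xi> * G"
  proof (cases "\<theta> = 0")
    case False
    have "\<mu> \<bullet> \<theta> \<le> (\<Sum>j\<in>UNIV. \<mu> $ j * infnorm \<theta>)"
      unfolding inner_vec_def inner_real_def
      using \<mu> abs_nth_le_infnorm[of \<theta>] unfolding less_eq_vec_def
      by (intro sum_mono mult_left_mono) (auto simp: abs_le_iff)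
    also have "\<dots> = (\<xi> * (\<Sum>j\<in>UNIV. \<mu> $ j)) * (infnorm \<theta> / \<xi>)"
      using xi by (simp add: sum_distrib_right[symmetric])
    also have "\<dots> \<le> G * (infnorm \<theta> / \<xi>)"
      using multiplier_bound[OF proper minorant compact_dom \<mu> opt fin xhat slater G[OF False]] xi
      by (intro mult_right_mono) (auto simp: infnorm_pos_le)
    finally show ?thesis by (simp add: mult.commute)
  qed (simp add: infnorm_0)
  then show ?thesis using shift by (elim order_trans[rotated]) simp
qed

section \<open>Constraint oscillation and the positive norm\<close>

lemma theta_row_bound:
  fixes p :: "'d::finite \<Rightarrow> 'n::finite" and A :: "real ^ 'd ^ 'm"
  assumes compact_dom: "\<And>i. compact (domX p f i)" and x: "x \<in> domX p f i" "x' \<in> domX p f i"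
  shows "(real CARD('m) + 1) * ((blk_mat p A i *v x) $ k - (blk_mat p A i *v x') $ k) \<le> theta p f A $ k"
proof -
  let ?g = "\<lambda>x. row k (blk_mat p A i) \<bullet> x"
  have bdd: "bounded (?g ` domX p f i)"
    using compact_dom by (intro compact_imp_bounded compact_continuous_image continuous_intros) auto
  have "?g x - ?g x' \<le> (SUP x\<in>domX p f i. ?g x) - (INF x\<in>domX p f i. ?g x)"
    using x bounded_imp_bdd_above[OF bdd] bounded_imp_bdd_below[OF bdd]
    by (intro diff_mono cSUP_upper cINF_lower)
  also have "\<dots> \<le> (MAX i\<in>UNIV. (SUP x\<in>domX p f i. row k (blk_mat p A i) \<bullet> x)
      - (INF x\<in>domX p f i. row k (blk_mat p A i) \<bullet> x))"
    by (rule Max_ge) auto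
  finally show ?thesis by (simp add: theta_def blk_mat_mult_nth)
qed

lemma pos_norm_mono:
  assumes "\<And>j. x $ j \<le> w $ j"
  shows "pos_norm x \<le> pos_norm w"
  unfolding pos_norm_def using assms
  by (intro real_sqrt_le_mono sum_mono power_mono max.mono) auto

lemma norm_pos_part: "norm (pos_part z) = sqrt ((max (fst z) 0)\<^sup>2 + (pos_norm (snd z))\<^sup>2)"
proof -
  have "(norm (pos_part z))\<^sup>2 = (max (fst z) 0)\<^sup>2 + (pos_norm (snd z))\<^sup>2"
    by (simp add: power2_norm_prod_vec pos_part_def pos_norm_def sum_nonneg)
  then show ?thesis by (metis norm_ge_zero real_sqrt_unique)
qed

lemma fst_le_norm_pos_part: "fst z \<le> norm (pos_part z)"
proof -
  have "fst z \<le> sqrt ((max (fst z) 0)\<^sup>2)" by simp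
  also have "\<dots> \<le> norm (pos_part z)" unfolding norm_pos_part by (intro real_sqrt_le_mono) simp
  finally show ?thesis .
qed

lemma pos_norm_snd_le_norm_pos_part: "pos_norm (snd z) \<le> norm (pos_part z)"
proof -
  have "pos_norm (snd z) = sqrt ((pos_norm (snd z))\<^sup>2)" by (simp add: pos_norm_def sum_nonneg)
  also have "\<dots> \<le> norm (pos_part z)" unfolding norm_pos_part by (intro real_sqrt_le_mono) simp
  finally show ?thesis .
qed

section \<open>Assembly of the objective and feasibility estimates\<close>

theorem theorem3p5:
  fixes p :: "'d::finite \<Rightarrow> 'n::finite"
    and f :: "'n \<Rightarrow> real ^ 'd \<Rightarrow> ereal"
    and A :: "real ^ 'd ^ 'm"
    and b \<theta> :: "real ^ 'm"
    and \<xi> :: real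
    and xhat xbar :: "real ^ 'd"
    and K q :: nat
    and y0 :: "'n \<Rightarrow> real ^ 'd"
    and y :: "nat \<Rightarrow> 'n \<Rightarrow> real ^ 'd"
    and z :: "nat \<Rightarrow> real \<times> (real ^ 'm)"
    and \<eta> \<gamma> \<alpha> :: "nat \<Rightarrow> real"
    and blkidx :: "nat \<Rightarrow> 'n"
    and itidx :: "nat \<Rightarrow> nat"
    and I :: "'n \<Rightarrow> nat set"
    and lsel :: "'n \<Rightarrow> nat"
  assumes proper: "\<And>i. proper_on (blk_space p i) (f i)"
    and lsc: "\<And>i. lsc_on (blk_space p i) (f i)"
    and minorant: "\<And>i. has_affine_minorant (blk_space p i) (f i)"
    and compact_dom: "\<And>i. compact (domX p f i)"
    and theta: "\<theta> = theta p f A"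
    and duality: "strong_duality p f A b"
    and duality_pert: "strong_duality p f A (b - \<theta>)"
    and xi: "\<xi> > 0"
    and xhat: "\<And>i. blk p i xhat \<in> convex hull (domX p f i)"
    and slater: "(\<Sum>i\<in>UNIV. blk_mat p A i *v blk p i xhat)
                   \<le> b - \<theta> - (real CARD('n) * \<xi>) *\<^sub>R 1"
    and K: "K \<ge> 1"
    and run: "fw_run p f A (real_of_ereal (relaxed_value p f A (b - \<theta>)), b - \<theta>) K y0 y z \<eta>"
    and gamma_nonneg: "\<And>k. k < K \<Longrightarrow> \<gamma> k \<ge> 0"
    and gamma_sum: "(\<Sum>k<K. \<gamma> k) = 1"
    and repr: "z K = (\<Sum>k<K. \<gamma> k *\<^sub>R fw_dir p f A (y k))"
    and alpha_nonneg: "\<And>l. l \<in> {1..CARD('n) + CARD('m) + 1} \<Longrightarrow> \<alpha> l \<ge> 0"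
    and itidx: "\<And>l. l \<in> {1..CARD('n) + CARD('m) + 1} \<Longrightarrow> itidx l < K"
    and caratheodory:
      "(fst (z K), snd (z K), 1 :: real ^ 'n) =
         (\<Sum>l = 1..CARD('n) + CARD('m) + 1.
            \<alpha> l *\<^sub>R (real_of_ereal (f (blkidx l) (y (itidx l) (blkidx l))),
                     blk_mat p A (blkidx l) *v y (itidx l) (blkidx l),
                     axis (blkidx l) 1))"
    and I: "\<And>i. I i = {l \<in> {1..CARD('n) + CARD('m) + 1}. blkidx l = i}"
    and lsel: "\<And>i. lsel i \<in> I i \<and> (\<forall>l\<in>I i. \<alpha> l \<le> \<alpha> (lsel i))"
    and xbar: "\<And>i. blk p i xbar = y (itidx (lsel i)) i"
    and q: "q = card {i. card (I i) > 1}"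
  shows "(\<Sum>i\<in>UNIV. f i (blk p i xbar))
           \<le> dual_value p f A b + 2 * D_C p f A / ereal (sqrt (real K + 1))
             + ereal (real q * (real CARD('m) + 1) / (real q + (real CARD('m) + 1)) + infnorm \<theta> / \<xi>)
               * (MAX i\<in>UNIV. gap p f i)
         \<and> ereal (pos_norm ((\<Sum>i\<in>UNIV. blk_mat p A i *v blk p i xbar) - b))
           \<le> 2 * D_C p f A / ereal (sqrt (real K + 1))"
proof -
  define N where "N = {1..CARD('n) + CARD('m) + 1}"
  define M where "M = real CARD('m) + 1"
  define u where "u = real_of_ereal (relaxed_value p f A (b - \<theta>))"
  define gf where "gf l = real_of_ereal (f (blkidx l) (y (itidx l) (blkidx l)))" for l
  define ga where "ga k l = (blk_mat p A (blkidx l) *v y (itidx l) (blkidx l)) $ k" for k l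
  have M: "0 < M" by (simp add: M_def)
  have I': "I i = {l \<in> N. blkidx l = i}" for i by (simp add: I N_def)
  have feas: "A *v xhat \<le> b - \<theta>"
  proof -
    have "(A *v xhat) $ j \<le> b $ j - \<theta> $ j - real CARD('n) * \<xi>" for j
      using slater unfolding sum_blk_mat_blk less_eq_vec_def by simp
    moreover have "0 \<le> real CARD('n) * \<xi>" using xi by simp
    ultimately show ?thesis unfolding less_eq_vec_def by (smt (verit) vector_minus_component)
  qed
  have optval: "relaxed_value p f A (b - \<theta>) = ereal u"
    unfolding u_def
    by (rule relaxed_value_finite[OF proper minorant compact_dom duality_pert feas xhat])
  have run': "fw_run p f A (u, b - \<theta>) K y0 y z \<eta>" using run by (simp add: u_def)
  have y_dom: "y k i \<in> domX p f i" if "k < K" for k i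
    using run' that unfolding fw_run_def fw_oracle_def Let_def by blast
  have yl_dom: "y (itidx l) i \<in> domX p f i" if "l \<in> I i" for l i
    using that itidx by (intro y_dom) (auto simp: I)
  have group: "(\<Sum>i\<in>UNIV. \<Sum>l\<in>I i. h l) = (\<Sum>l\<in>N. h l)" for h :: "nat \<Rightarrow> real"
    unfolding I' by (rule sum.group) (auto simp: N_def)
  have fin: "finite (I i)" for i by (simp add: I)
  have zf: "fst (z K) = (\<Sum>i\<in>UNIV. \<Sum>l\<in>I i. \<alpha> l * gf l)"
    unfolding group using arg_cong[OF caratheodory, of fst] by (simp add: fst_sum gf_def N_def)
  have za: "snd (z K) $ k = (\<Sum>i\<in>UNIV. \<Sum>l\<in>I i. \<alpha> l * ga k l)" for k
    unfolding group using arg_cong[OF caratheodory, of "\<lambda>w. fst (snd w) $ k"]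
    by (simp add: fst_sum snd_sum ga_def N_def)
  \<comment> \<open>The e_i components of the conic combination force the weights of each block to
    be convex weights.\<close>
  have one: "(\<Sum>l\<in>I i. \<alpha> l) = 1" for i
  proof -
    have "1 = (\<Sum>l\<in>N. \<alpha> l * (axis (blkidx l) 1 :: real ^ 'n) $ i)"
      using arg_cong[OF caratheodory, of "\<lambda>w. snd (snd w) $ i"] by (simp add: snd_sum N_def)
    also have "\<dots> = (\<Sum>l\<in>N. if blkidx l = i then \<alpha> l else 0)"
      by (intro sum.cong) (auto simp: axis_def)
    also have "\<dots> = (\<Sum>l\<in>I i. \<alpha> l)"
      unfolding I' by (rule sum.inter_filter[symmetric]) (simp add: N_def)
    finally show ?thesis by simp
  qed
  \<comment> \<open>The sets \<open>I i\<close> partition the n + m + 1 indices, so the excess over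
    one atom per block is \<open>M\<close> = m + 1.\<close>
  have card: "(\<Sum>i\<in>UNIV. real (card (I i))) = real CARD('n) + M"
    using group[of "\<lambda>_. 1"] by (simp add: N_def M_def)
  have nonneg: "0 \<le> \<alpha> l" if "l \<in> I i" for i l using that alpha_nonneg by (simp add: I)
  note rounding = block_rounding[where I = I and \<alpha> = \<alpha>, OF fin nonneg one lsel card M q]
  have blk_lsel: "blkidx (lsel i) = i" for i using lsel[of i] by (simp add: I)

  have violation: "(\<Sum>i\<in>UNIV. blk_mat p A i *v blk p i xbar) $ k \<le> snd (z K) $ k + \<theta> $ k" for k
  proof -
    have row: "ga k l - ga k l' \<le> \<theta> $ k / M" if "l \<in> I i" "l' \<in> I i" for i l l'
      using theta_row_bound[OF compact_dom yl_dom[OF that(1)] yl_dom[OF that(2)], of A k] that M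
      by (simp add: ga_def theta M_def I field_simps)
    have "0 \<le> \<theta> $ k" using row[of "lsel i" i "lsel i" for i] lsel M by (simp add: zero_le_divide_iff)
    \<comment> \<open>Each row oscillates by at most \<theta>_k / M within a block, and q M / (q +
      M) is at most M, so rounding costs at most \<theta>_k.\<close>
    then have "real q * M / (real q + M) * (\<theta> $ k / M) \<le> \<theta> $ k"
      using M by (simp add: divide_simps) (simp add: algebra_simps)
    moreover have "(\<Sum>i\<in>UNIV. ga k (lsel i)) \<le> snd (z K) $ k + real q * M / (real q + M) * (\<theta> $ k / M)"
      unfolding za by (rule rounding, assumption, rule row)
    ultimately show ?thesis by (simp add: ga_def blk_lsel xbar)
  qed

  have dirC: "fw_dir p f A y0 \<in> C_sum p f A"
    using run' unfolding fw_run_def Let_def by (intro fw_dir_in_C_sum) blast+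
  show ?thesis
  \<comment> \<open>An infinite diameter makes both bounds trivial; minus infinity is excluded
    because C is nonempty.\<close>
  proof (cases "D_C p f A")
    case PInf
    then show ?thesis by simp
  next
    case MInf
    with norm_diff_le_D_C[OF dirC dirC] show ?thesis by simp
  next
    case (real D)
    define r where "r = 2 * D / sqrt (real K + 1)"
    have r: "2 * D_C p f A / ereal (sqrt (real K + 1)) = ereal r"
      unfolding real r_def by simp
    have res: "norm (pos_part (z K - (u, b - \<theta>))) \<le> r"
      unfolding r_def by (rule fw_residual_bound[OF proper minorant optval run' K real])
    \<comment> \<open>The target b - \<theta> leaves room for the rounding error \<theta>, so the
      residual against b is dominated by that of \<open>z K\<close> against b - \<theta>.\<close>
    have "pos_norm ((\<Sum>i\<in>UNIV. blk_mat p A i *v blk p i xbar) - b)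
        \<le> pos_norm (snd (z K - (u, b - \<theta>)))"
      using violation by (intro pos_norm_mono) (simp add: algebra_simps)
    also have "\<dots> \<le> r" using pos_norm_snd_le_norm_pos_part res by (rule order_trans)
    finally have feasibility: "pos_norm ((\<Sum>i\<in>UNIV. blk_mat p A i *v blk p i xbar) - b) \<le> r" .

    have value_fst: "fst (z K) \<le> u + r"
      using fst_le_norm_pos_part[of "z K - (u, b - \<theta>)"] res by simp
    define F where "F = (\<Sum>i\<in>UNIV. gf (lsel i))"
    have F: "(\<Sum>i\<in>UNIV. f i (blk p i xbar)) = ereal F"
    proof -
      have "f i (blk p i xbar) = ereal (gf (lsel i))" for i
        using domX_finite_value[OF proper yl_dom[of "lsel i" i]] lsel by (simp add: gf_def blk_lsel xbar)
      then show ?thesis by (simp add: F_def)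
    qed
    define c where "c = real q * M / (real q + M)"
    define Gm where "Gm = (MAX i\<in>UNIV. gap p f i)"
    \<comment> \<open>Stated for a real \<open>G\<close> that must bound the gaps only if their
      coefficient can be nonzero; this allows for infinite gaps.\<close>
    have bound: "ereal F \<le> dual_value p f A b + ereal r + ereal ((c + infnorm \<theta> / \<xi>) * G)"
      if G: "\<theta> \<noteq> 0 \<or> 0 < q \<Longrightarrow> (\<And>i. gap p f i \<le> ereal G)" for G
    proof -
      have "F \<le> fst (z K) + c * G"
        unfolding F_def zf c_def
      proof (rule rounding)
        fix i l l' assume i: "1 < card (I i)" and l: "l \<in> I i" "l' \<in> I i"
        have "0 < q" unfolding q using i by (auto simp: card_gt_0_iff)
        then have "f i (y (itidx l) i) - f i (y (itidx l') i) \<le> ereal G"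
          using gap_ge_diff[OF yl_dom[OF l(1)] yl_dom[OF l(2)]] G order_trans by blast
        then show "gf l - gf l' \<le> G"
          using domX_finite_value[OF proper yl_dom[OF l(1)]] domX_finite_value[OF proper yl_dom[OF l(2)]] l
          by (metis (mono_tags, lifting) I mem_Collect_eq gf_def ereal_minus(1) ereal_less_eq(3))
      qed
      \<comment> \<open>The price of \<theta> is subtracted and added back, so that
        \<open>perturbation_bound\<close> applies to the first term.\<close>
      with value_fst have "ereal F \<le> ereal (u - infnorm \<theta> / \<xi> * G) + ereal r + ereal ((c + infnorm \<theta> / \<xi>) * G)"
        by (simp add: algebra_simps)
      also have "\<dots> \<le> dual_value p f A b + ereal r + ereal ((c + infnorm \<theta> / \<xi>) * G)"
        using perturbation_bound[OF proper minorant compact_dom duality_pert optval xi xhat slater, of G] G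
        by (intro add_mono order_refl) blast
      finally show ?thesis .
    qed
    have "ereal F \<le> dual_value p f A b + ereal r + ereal (c + infnorm \<theta> / \<xi>) * Gm"
    \<comment> \<open>In this case the coefficient is 0, and 0 times infinity is 0 for
      \<open>ereal\<close>, so the estimate with \<open>G\<close> = 0 is required. Otherwise the
      coefficient is positive and an infinite gap makes the bound trivial.\<close>
    proof (cases "\<theta> = 0 \<and> q = 0")
      case True
      then show ?thesis using bound[of 0] by (simp add: c_def infnorm_0 zero_ereal_def[symmetric])
    next
      case False
      have pos: "0 < c + infnorm \<theta> / \<xi>"
        using False M xi infnorm_pos_lt[of \<theta>] infnorm_pos_le[of \<theta>]
        by (cases "q = 0") (auto simp: c_def intro: add_pos_nonneg)
      have gap_le: "gap p f i \<le> Gm" for i unfolding Gm_def by (rule Max_ge) auto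
      show ?thesis
      proof (cases Gm)
        case (real G)
        then show ?thesis using bound[of G] gap_le by simp
      next
        case PInf
        then show ?thesis using pos by simp
      next
        \<comment> \<open>Impossible: comparing the domain point \<open>y 0 i\<close>, available
          because K is at least 1, with itself shows that the gap is nonnegative.\<close>
        case MInf
        fix i
        have y: "y 0 i \<in> domX p f i" using K by (intro y_dom) simp
        have "f i (y 0 i) - f i (y 0 i) \<le> Gm"
          using gap_ge_diff[OF y y] gap_le by (rule order_trans)
        then show ?thesis using MInf domX_finite_value[OF proper y]
          by (cases "f i (y 0 i)") auto
      qed
    qed
    then show ?thesis
      using feasibility unfolding r F c_def M_def Gm_def by simp
  qed
qed

end
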